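(* Let $\mu$ be a Borel probability measure on $\mathbb{R}$ with compact support and let $\Gamma\subset\mathbb{R}$ be a countable set. Assume there exists a bounded linear operator $S:\ell^2(\Gamma)\to L^2(\mu)$ with $S(\delta_\gamma)=e_\gamma$ for all $\gamma\in\Gamma$. Then the function $c_\Gamma(t)=\sum_{\gamma\in\Gamma}|\widehat\mu(\gamma+t)|^2$ ($t\in\mathbb{R}$) has an entire analytic extension to the complex plane $\mathbb{C}$.
   Context: Here $e_\gamma(x)=e^{2\pi i\gamma x}$, $\{\delta_\gamma:\gamma\in\Gamma\}$ is the standard orthonormal basis of $\ell^2(\Gamma)$, and $\widehat\mu(t)=\int_{\mathbb{R}} e^{2\pi i x t}\,d\mu(x)$. The function $c_\Gamma$ is called the spectral function; equivalently $c_\Gamma(t)=\sum_{\gamma\in\Gamma}|\langle e_\gamma,e_{-t}\rangle_{L^2(\mu)}|^2$. *)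

theory Defs
  imports "HOL-Probability.Probability" "HOL-Complex_Analysis.Complex_Analysis"
begin

definition measure_support :: "'a::topological_space measure \<Rightarrow> 'a set" where
  "measure_support \<mu> = {x. \<forall>U. open U \<and> x \<in> U \<longrightarrow> emeasure \<mu> U > 0}"

definition expo :: "real \<Rightarrow> real \<Rightarrow> complex" where
  "expo \<gamma> x = exp (2 * of_real pi * \<i> * of_real \<gamma> * of_real x)"

definition fourier_transform :: "real measure \<Rightarrow> real \<Rightarrow> complex" where
  "fourier_transform \<mu> t = (LINT x|\<mu>. exp (2 * of_real pi * \<i> * of_real x * of_real t))"

(* Elements are families indexed by I, encoded as functions vanishing outside I,
   so that equality of elements is equality of functions. *)
definition l2_space :: "'i set \<Rightarrow> ('i \<Rightarrow> complex) set" where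
  "l2_space I = {a. (\<forall>i. i \<notin> I \<longrightarrow> a i = 0) \<and> (\<lambda>i. (cmod (a i))\<^sup>2) summable_on I}"

definition l2_norm :: "'i set \<Rightarrow> ('i \<Rightarrow> complex) \<Rightarrow> real" where
  "l2_norm I a = sqrt (\<Sum>\<^sub>\<infinity>i\<in>I. (cmod (a i))\<^sup>2)"

definition delta :: "'i \<Rightarrow> 'i \<Rightarrow> complex" where
  "delta i = (\<lambda>j. if j = i then 1 else 0)"

(* Square-integrable functions, i.e. representatives: identification of functions that agree
   almost everywhere is not built into the space but into the relation AE below. *)
definition L2_space :: "'a measure \<Rightarrow> ('a \<Rightarrow> complex) set" where
  "L2_space \<mu> = {f \<in> borel_measurable \<mu>. integrable \<mu> (\<lambda>x. (cmod (f x))\<^sup>2)}"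

definition L2_norm :: "'a measure \<Rightarrow> ('a \<Rightarrow> complex) \<Rightarrow> real" where
  "L2_norm \<mu> f = sqrt (LINT x|\<mu>. (cmod (f x))\<^sup>2)"

(* Bounded complex-linear operators from l2(I) to L2(mu); S a is a representative of the image
   class of a, so linearity is required only almost everywhere. *)
definition bounded_l2_L2_operator ::
    "'i set \<Rightarrow> 'a measure \<Rightarrow> (('i \<Rightarrow> complex) \<Rightarrow> ('a \<Rightarrow> complex)) \<Rightarrow> bool" where
  "bounded_l2_L2_operator I \<mu> S \<longleftrightarrow>
     (\<forall>a\<in>l2_space I. S a \<in> L2_space \<mu>) \<and>
     (\<forall>a\<in>l2_space I. \<forall>b\<in>l2_space I. AE x in \<mu>. S (\<lambda>i. a i + b i) x = S a x + S b x) \<and>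
     (\<forall>c. \<forall>a\<in>l2_space I. AE x in \<mu>. S (\<lambda>i. c * a i) x = c * S a x) \<and>
     (\<exists>C. \<forall>a\<in>l2_space I. L2_norm \<mu> (S a) \<le> C * l2_norm I a)"

definition spectral_function :: "real measure \<Rightarrow> real set \<Rightarrow> real \<Rightarrow> real" where
  "spectral_function \<mu> \<Gamma> t = (\<Sum>\<^sub>\<infinity>\<gamma>\<in>\<Gamma>. (cmod (fourier_transform \<mu> (\<gamma> + t)))\<^sup>2)"

end

(* The functions h_gamma(z) = int e_gamma(x) exp(2 pi i x z) d mu(x) are entire and extend
   t |-> fourier_transform mu (gamma + t). Boundedness of S dualizes to the Bessel inequality
   sum_gamma |h_gamma(z)|^2 <= B ||exp(2 pi i x z)||^2, whose right-hand side is bounded for z in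
   compact sets because mu has compact support. Hence the partial sums of
   sum_gamma h_gamma(z) cnj(h_gamma(cnj z)), an entire candidate that agrees with the spectral
   function on the real line, converge pointwise and are locally bounded, and by Montel's theorem
   the limit is entire. *)
theory Submission imports Defs begin

section \<open>Null sets outside the support\<close>

text \<open>The complement of the support is the union of all open null sets. By the Lindelof
  property countably many of them already cover this union, so it is null. This turns compact
  support into an almost everywhere bound on |x|.\<close>

lemma AE_in_measure_support:
  fixes M :: "'a::second_countable_topology measure"
  assumes "sets M = sets borel"
  shows "AE x in M. x \<in> measure_support M"
proof -
  define \<N> where "\<N> = {U. open U \<and> emeasure M U = 0}"
  obtain \<N>' where sub: "\<N>' \<subseteq> \<N>" and "countable \<N>'" and Un: "\<Union>\<N>' = \<Union>\<N>"
    by (rule Lindelof[of \<N>]) (auto simp: \<N>_def)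
  have "U \<in> null_sets M" if "U \<in> \<N>'" for U
    using sub that assms by (auto simp: \<N>_def null_sets_def)
  with \<open>countable \<N>'\<close> have "\<Union>\<N>' \<in> null_sets M"
    using null_sets_UN'[of \<N>' id M] by simp
  then show ?thesis
  proof (rule AE_I')
    show "{x \<in> space M. x \<notin> measure_support M} \<subseteq> \<Union>\<N>'"
      unfolding Un by (auto simp: measure_support_def \<N>_def)
  qed
qed

section \<open>From boundedness of \<open>S\<close> to the Bessel inequality\<close>

lemma
  assumes "bounded_l2_L2_operator I M S" "a \<in> l2_space I"
  shows bounded_l2_L2_operator_add:
      "b \<in> l2_space I \<Longrightarrow> AE x in M. S (\<lambda>i. a i + b i) x = S a x + S b x"
    and bounded_l2_L2_operator_scale: "AE x in M. S (\<lambda>i. c * a i) x = c * S a x"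
  using assms unfolding bounded_l2_L2_operator_def by simp_all

text \<open>As \<open>S\<close> is additive and homogeneous only up to null sets, finite
  combinations are treated by induction on \<open>F\<close>: each step adds only finitely many
  exceptional null sets.\<close>

lemma synthesis_finite:
  assumes S: "bounded_l2_L2_operator I M S"
    and e: "\<And>i. i \<in> I \<Longrightarrow> AE x in M. S (delta i) x = e i x"
    and "finite F" "F \<subseteq> I"
  shows "AE x in M. S (\<lambda>i. if i \<in> F then a i else 0) x = (\<Sum>i\<in>F. a i * e i x)"
  using \<open>finite F\<close> \<open>F \<subseteq> I\<close>
proof (induction F)
  case empty
  have "(\<lambda>_. 0) \<in> l2_space I"
    by (simp add: l2_space_def)
  \<comment> \<open>Homogeneity with the scalar 0 shows that \<open>S\<close> sends the zero vector
    to 0 almost everywhere.\<close>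
  from bounded_l2_L2_operator_scale[OF S this, of 0] show ?case
    by simp
next
  case (insert j F)
  have l2: "(\<lambda>i. if i \<in> G then b i else 0) \<in> l2_space I" if "finite G" "G \<subseteq> I" for G b
  proof -
    have "(\<lambda>i. (cmod (b i))\<^sup>2) summable_on G"
      using that by simp
    then have "(\<lambda>i. (cmod (if i \<in> G then b i else 0))\<^sup>2) summable_on I"
      by (rule summable_on_cong_neutral[THEN iffD1, rotated -1]) (use that in auto)
    then show ?thesis
      using that by (auto simp: l2_space_def)
  qed
  have d: "delta j = (\<lambda>i. if i \<in> {j} then 1 else 0)"
    by (auto simp: delta_def)
  have dl2: "delta j \<in> l2_space I"
    unfolding d using insert.prems by (intro l2) auto
  have jl2: "(\<lambda>i. a j * delta j i) \<in> l2_space I"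
    using l2[of "{j}" "\<lambda>_. a j"] insert.prems by (simp add: delta_def if_distrib cong: if_cong)
  have Fl2: "(\<lambda>i. if i \<in> F then a i else 0) \<in> l2_space I"
    using insert by (intro l2) auto
  have eq: "(\<lambda>i. if i \<in> insert j F then a i else 0)
      = (\<lambda>i. a j * delta j i + (if i \<in> F then a i else 0))"
    using insert.hyps by (auto simp: delta_def)
  have "AE x in M. S (\<lambda>i. a j * delta j i + (if i \<in> F then a i else 0)) x
      = S (\<lambda>i. a j * delta j i) x + S (\<lambda>i. if i \<in> F then a i else 0) x"
    by (rule bounded_l2_L2_operator_add[OF S jl2 Fl2])
  moreover have "AE x in M. S (\<lambda>i. a j * delta j i) x = a j * S (delta j) x"
    by (rule bounded_l2_L2_operator_scale[OF S dl2])
  moreover have "AE x in M. S (delta j) x = e j x"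
    using e insert.prems by auto
  moreover have "AE x in M. S (\<lambda>i. if i \<in> F then a i else 0) x = (\<Sum>i\<in>F. a i * e i x)"
    using insert by auto
  ultimately show ?case
    unfolding eq by eventually_elim (use insert.hyps in simp)
qed

text \<open>This is the operator bound on finitely supported vectors. Integrability is recorded as
  well because the integral of a non-integrable function is 0 by convention, so that the estimate
  alone would carry no information.\<close>

lemma synthesis_bound:
  assumes S: "bounded_l2_L2_operator I M S"
    and e: "\<And>i. i \<in> I \<Longrightarrow> AE x in M. S (delta i) x = e i x"
    and meas: "\<And>i. i \<in> I \<Longrightarrow> e i \<in> borel_measurable M"
  obtains C where "C \<ge> 0"
    and "\<And>F a. finite F \<Longrightarrow> F \<subseteq> I \<Longrightarrow> integrable M (\<lambda>x. (cmod (\<Sum>i\<in>F. a i * e i x))\<^sup>2)"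
    and "\<And>F a. finite F \<Longrightarrow> F \<subseteq> I \<Longrightarrow>
      (LINT x|M. (cmod (\<Sum>i\<in>F. a i * e i x))\<^sup>2) \<le> C * (\<Sum>i\<in>F. (cmod (a i))\<^sup>2)"
proof -
  obtain C where C: "\<And>a. a \<in> l2_space I \<Longrightarrow> L2_norm M (S a) \<le> C * l2_norm I a"
    using S unfolding bounded_l2_L2_operator_def by blast
  have *: "integrable M (\<lambda>x. (cmod (\<Sum>i\<in>F. a i * e i x))\<^sup>2) \<and>
      (LINT x|M. (cmod (\<Sum>i\<in>F. a i * e i x))\<^sup>2) \<le> C\<^sup>2 * (\<Sum>i\<in>F. (cmod (a i))\<^sup>2)"
    if F: "finite F" "F \<subseteq> I" for F a
  proof -
    define b where "b = (\<lambda>i. if i \<in> F then a i else 0)"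
    define P where "P = (\<lambda>x. \<Sum>i\<in>F. a i * e i x)"
    have hs: "((\<lambda>i. (cmod (b i))\<^sup>2) has_sum (\<Sum>i\<in>F. (cmod (a i))\<^sup>2)) I"
      by (rule has_sum_cong_neutral[THEN iffD1, OF _ _ _ has_sum_finite])
        (use F in \<open>auto simp: b_def\<close>)
    then have b: "b \<in> l2_space I"
      using F by (auto simp: l2_space_def b_def summable_on_def)
    have norm_b: "l2_norm I b = sqrt (\<Sum>i\<in>F. (cmod (a i))\<^sup>2)"
      using hs by (simp add: l2_norm_def infsumI)
    have AE: "AE x in M. S b x = P x"
      unfolding b_def P_def using S e F by (rule synthesis_finite)
    have Sb: "S b \<in> borel_measurable M" "integrable M (\<lambda>x. (cmod (S b x))\<^sup>2)"
      using S b unfolding bounded_l2_L2_operator_def L2_space_def by auto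
    have P: "P \<in> borel_measurable M"
      unfolding P_def using meas F by (intro borel_measurable_sum borel_measurable_times) auto
    have AE': "AE x in M. (cmod (S b x))\<^sup>2 = (cmod (P x))\<^sup>2"
      using AE by eventually_elim simp
    have "integrable M (\<lambda>x. (cmod (P x))\<^sup>2)"
      by (rule integrable_cong_AE_imp[OF Sb(2) _ AE']) (use P in measurable)
    moreover have "(LINT x|M. (cmod (P x))\<^sup>2) = (LINT x|M. (cmod (S b x))\<^sup>2)"
      using AE' by (intro integral_cong_AE) (use P Sb in \<open>auto elim: eventually_mono\<close>)
    moreover have "(LINT x|M. (cmod (S b x))\<^sup>2) = (L2_norm M (S b))\<^sup>2"
      by (simp add: L2_norm_def)
    moreover have "(L2_norm M (S b))\<^sup>2 \<le> (C * l2_norm I b)\<^sup>2"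
      by (rule power_mono[OF C[OF b]]) (simp add: L2_norm_def)
    moreover have "(C * l2_norm I b)\<^sup>2 = C\<^sup>2 * (\<Sum>i\<in>F. (cmod (a i))\<^sup>2)"
      by (simp add: norm_b power_mult_distrib sum_nonneg)
    ultimately show ?thesis
      unfolding P_def by simp
  qed
  show thesis
    \<comment> \<open>The bound concerns squared norms, so the constant is squared too; this makes
      it nonnegative whatever the sign of \<open>C\<close>.\<close>
    by (rule that[of "C\<^sup>2"]) (use * in auto)
qed

text \<open>Duality: pairing \<open>g\<close> with a suitable finite combination of the
  \<open>e i\<close> turns the sum of squared coefficients into a single integral, to which the
  synthesis bound applies. The pairing has no conjugate, so that it can later produce the Fourier
  transform directly.\<close>

lemma bessel_bound:
  assumes S: "bounded_l2_L2_operator I M S"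
    and e: "\<And>i. i \<in> I \<Longrightarrow> AE x in M. S (delta i) x = e i x"
    and meas: "\<And>i. i \<in> I \<Longrightarrow> e i \<in> borel_measurable M"
  obtains B where "B \<ge> 0"
    and "\<And>F g. \<lbrakk>finite F; F \<subseteq> I; integrable M (\<lambda>x. (cmod (g x))\<^sup>2);
            \<And>i. i \<in> F \<Longrightarrow> integrable M (\<lambda>x. e i x * g x)\<rbrakk> \<Longrightarrow>
      (\<Sum>i\<in>F. (cmod (LINT x|M. e i x * g x))\<^sup>2) \<le> B * (LINT x|M. (cmod (g x))\<^sup>2)"
proof -
  obtain C where "C \<ge> 0"
    and int: "\<And>F a. finite F \<Longrightarrow> F \<subseteq> I \<Longrightarrow> integrable M (\<lambda>x. (cmod (\<Sum>i\<in>F. a i * e i x))\<^sup>2)"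
    and bound: "\<And>F a. finite F \<Longrightarrow> F \<subseteq> I \<Longrightarrow>
      (LINT x|M. (cmod (\<Sum>i\<in>F. a i * e i x))\<^sup>2) \<le> C * (\<Sum>i\<in>F. (cmod (a i))\<^sup>2)"
    by (rule synthesis_bound[OF S e meas]) auto
  show thesis
  \<comment> \<open>Adding 1 makes the constant strictly positive, since the weighted estimate
    divides by it.\<close>
  proof (rule that[of "C + 1"])
    fix F and g :: "'b \<Rightarrow> complex"
    assume F: "finite F" "F \<subseteq> I" and g: "integrable M (\<lambda>x. (cmod (g x))\<^sup>2)"
      and eg: "\<And>i. i \<in> F \<Longrightarrow> integrable M (\<lambda>x. e i x * g x)"
    define b where "b = (\<lambda>i. LINT x|M. e i x * g x)"
    define N where "N = (\<Sum>i\<in>F. (cmod (b i))\<^sup>2)"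
    \<comment> \<open>With conjugated coefficients the integral of \<open>P * g\<close> is exactly
      \<open>N\<close>.\<close>
    define P where "P = (\<lambda>x. \<Sum>i\<in>F. cnj (b i) * e i x)"
    have Pg: "P x * g x = (\<Sum>i\<in>F. cnj (b i) * (e i x * g x))" for x
      by (simp add: P_def sum_distrib_right mult.assoc)
    have iPg: "integrable M (\<lambda>x. P x * g x)"
      unfolding Pg using eg by (intro Bochner_Integration.integrable_sum integrable_mult_right) auto
    have iP: "integrable M (\<lambda>x. (cmod (P x))\<^sup>2)" and PN: "(LINT x|M. (cmod (P x))\<^sup>2) \<le> C * N"
      using int[OF F, of "\<lambda>i. cnj (b i)"] bound[OF F, of "\<lambda>i. cnj (b i)"]
      by (simp_all add: P_def N_def)
    have "N \<ge> 0"
      by (simp add: N_def sum_nonneg)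
    (* AM-GM with weight C + 1: the P-term is at most N/2 and is absorbed on the left. *)
    have "(LINT x|M. P x * g x) = (\<Sum>i\<in>F. cnj (b i) * b i)"
      unfolding Pg using eg by (subst Bochner_Integration.integral_sum) (auto simp: b_def)
    also have "\<dots> = of_real N"
      by (simp add: N_def complex_norm_square mult.commute del: of_real_power)
    finally have "N = cmod (LINT x|M. P x * g x)"
      using \<open>N \<ge> 0\<close> by simp
    also have "\<dots> \<le> (LINT x|M. cmod (P x * g x))"
      by (rule integral_norm_bound)
    also have "\<dots> \<le> (LINT x|M. (cmod (P x))\<^sup>2 / (2 * (C + 1)) + (C + 1) / 2 * (cmod (g x))\<^sup>2)"
    proof (rule integral_mono)
      fix x
      have "2 * (C + 1) * (cmod (P x) * cmod (g x)) \<le> (cmod (P x))\<^sup>2 + (C + 1)\<^sup>2 * (cmod (g x))\<^sup>2"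
        using zero_le_power2[of "cmod (P x) - (C + 1) * cmod (g x)"]
        by (simp add: power2_eq_square algebra_simps)
      then show "cmod (P x * g x) \<le> (cmod (P x))\<^sup>2 / (2 * (C + 1)) + (C + 1) / 2 * (cmod (g x))\<^sup>2"
        using \<open>C \<ge> 0\<close> by (simp add: norm_mult field_simps power2_eq_square)
    qed (use iPg iP g in auto)
    also have "\<dots> = (LINT x|M. (cmod (P x))\<^sup>2) / (2 * (C + 1)) + (C + 1) / 2 * (LINT x|M. (cmod (g x))\<^sup>2)"
      using iP g by simp
    also have "(LINT x|M. (cmod (P x))\<^sup>2) / (2 * (C + 1)) \<le> N / 2"
    proof -
      have "(LINT x|M. (cmod (P x))\<^sup>2) \<le> (C + 1) * N"
        using PN \<open>N \<ge> 0\<close> by (simp add: algebra_simps)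
      then show ?thesis
        using \<open>C \<ge> 0\<close> by (simp add: field_simps)
    qed
    finally show "(\<Sum>i\<in>F. (cmod (LINT x|M. e i x * g x))\<^sup>2) \<le> (C + 1) * (LINT x|M. (cmod (g x))\<^sup>2)"
      by (simp add: N_def b_def)
  qed (use \<open>C \<ge> 0\<close> in simp)
qed

section \<open>Entire extension of the Fourier transform\<close>

text \<open>Expanding the exponential and integrating term by term gives a power series in
  \<open>z\<close> that converges everywhere, with moments of \<open>f\<close> as coefficients.
  Since |x| is at most \<open>R\<close> almost everywhere, the n-th term is dominated by
  \<open>cmod (f x) * s ^ n / fact n\<close> with \<open>s = cmod c * R * cmod z\<close>, which
  justifies the exchange of sum and integral.\<close>

lemma holomorphic_fourier_laplace:
  fixes M :: "real measure" and f :: "real \<Rightarrow> complex"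
  assumes f: "integrable M f" and sets: "sets M = sets borel"
    and R: "AE x in M. \<bar>x\<bar> \<le> R"
  shows "(\<lambda>z. LINT x|M. f x * exp (c * of_real x * z)) holomorphic_on UNIV"
proof -
  note [measurable_cong] = sets
  have [measurable]: "f \<in> borel_measurable M"
    using f by auto
  define a where "a n = (LINT x|M. f x * (c * of_real x) ^ n /\<^sub>R fact n)" for n
  have sums: "(\<lambda>n. a n * z ^ n) sums (LINT x|M. f x * exp (c * of_real x * z))" for z
  proof -
    define s where "s = cmod c * R * cmod z"
    define h where "h n x = f x * ((c * of_real x * z) ^ n /\<^sub>R fact n)" for n x
    have bound: "AE x in M. norm (h n x) \<le> cmod (f x) * (s ^ n /\<^sub>R fact n)" for n
      using R
    proof eventually_elim
      case (elim x)
      have "cmod (c * of_real x * z) \<le> s"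
        using elim by (auto simp: s_def norm_mult intro!: mult_right_mono mult_left_mono)
      then have "cmod (c * of_real x * z) ^ n \<le> s ^ n"
        by (intro power_mono) auto
      then have "cmod ((c * of_real x * z) ^ n /\<^sub>R fact n) \<le> s ^ n /\<^sub>R fact n"
        unfolding norm_scaleR norm_power by (simp add: divide_right_mono field_simps)
      then show ?case
        unfolding h_def norm_mult[of "f x"] by (rule mult_left_mono) simp
    qed
    have int_bound: "integrable M (\<lambda>x. cmod (f x) * (s ^ n /\<^sub>R fact n))" for n
      using f by auto
    have [measurable]: "h n \<in> borel_measurable M" for n
      unfolding h_def[abs_def] by measurable
    have int_h: "integrable M (h n)" for n
      by (rule Bochner_Integration.integrable_bound[OF int_bound[of n]])
        (use bound[of n] in \<open>auto elim!: eventually_mono\<close>)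
    have s1: "AE x in M. summable (\<lambda>n. norm (h n x))"
    proof (rule AE_I2)
      fix x
      have "summable (\<lambda>n. cmod (f x) * (cmod (c * of_real x * z) ^ n /\<^sub>R fact n))"
        by (intro summable_mult summable_exp_generic)
      then show "summable (\<lambda>n. norm (h n x))"
        unfolding h_def norm_mult[of "f x"] norm_scaleR norm_power by simp
    qed
    have s2: "summable (\<lambda>n. LINT x|M. norm (h n x))"
    proof (rule summable_comparison_test')
      show "summable (\<lambda>n. (LINT x|M. cmod (f x)) * (s ^ n /\<^sub>R fact n))"
        by (intro summable_mult summable_exp_generic)
      show "norm (LINT x|M. norm (h n x)) \<le> (LINT x|M. cmod (f x)) * (s ^ n /\<^sub>R fact n)" for n
      proof -
        have "(LINT x|M. norm (h n x)) \<le> (LINT x|M. cmod (f x) * (s ^ n /\<^sub>R fact n))"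
          by (rule integral_mono_AE) (use int_h int_bound bound in auto)
        then show ?thesis
          by simp
      qed
    qed
    have "(\<lambda>n. LINT x|M. h n x) sums (LINT x|M. (\<Sum>n. h n x))"
      using int_h s1 s2 by (rule sums_integral)
    moreover have "(\<Sum>n. h n x) = f x * exp (c * of_real x * z)" for x
      unfolding h_def by (subst suminf_mult[OF summable_exp_generic]) (simp add: exp_def)
    moreover have "(LINT x|M. h n x) = a n * z ^ n" for n
    proof -
      have "h n x = (f x * (c * of_real x) ^ n /\<^sub>R fact n) * z ^ n" for x
        by (simp add: h_def power_mult_distrib)
      then show ?thesis
        by (simp add: a_def)
    qed
    ultimately show ?thesis
      by simp
  qed
  \<comment> \<open>The coefficients \<open>a n\<close> do not depend on \<open>z\<close>, so the
    same series serves on every ball around 0, and these balls exhaust the plane.\<close>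
  have "(\<lambda>z. LINT x|M. f x * exp (c * of_real x * z)) holomorphic_on ball 0 r" for r
    by (rule power_series_holomorphic[where a = a]) (use sums in simp)
  then have "(\<lambda>z. LINT x|M. f x * exp (c * of_real x * z)) holomorphic_on (\<Union>r. ball 0 r)"
    by (subst holomorphic_on_UN_open) auto
  moreover have "(\<Union>r. ball 0 r) = (UNIV :: complex set)"
    by (metis UNIV_eq_I UN_I iso_tuple_UNIV_I mem_ball_0 gt_ex)
  ultimately show ?thesis
    by simp
qed

section \<open>Holomorphic limits and series\<close>

text \<open>Montel yields a subsequence with a holomorphic limit; pointwise convergence of the whole
  sequence forces that limit to be \<open>F\<close>.\<close>

lemma holomorphic_pointwise_limit_bounded:
  fixes f :: "nat \<Rightarrow> complex \<Rightarrow> complex"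
  assumes "open S" "\<And>n. f n holomorphic_on S"
    and bounded: "\<And>K. compact K \<Longrightarrow> K \<subseteq> S \<Longrightarrow> \<exists>B. \<forall>n. \<forall>z\<in>K. cmod (f n z) \<le> B"
    and lim: "\<And>z. z \<in> S \<Longrightarrow> (\<lambda>n. f n z) \<longlonglongrightarrow> F z"
  shows "F holomorphic_on S"
proof -
  obtain g r where g: "g holomorphic_on S" "strict_mono (r :: nat \<Rightarrow> nat)"
    "\<And>z. z \<in> S \<Longrightarrow> (\<lambda>n. f (r n) z) \<longlonglongrightarrow> g z"
    by (rule Montel[of S "range f" f]) (use assms in auto)
  have "g z = F z" if "z \<in> S" for z
    using LIMSEQ_subseq_LIMSEQ[OF lim[OF that] g(2)] g(3)[OF that]
    by (auto simp: o_def intro: LIMSEQ_unique)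
  with g(1) show ?thesis
    by (rule holomorphic_transform)
qed

text \<open>Infinite sums are limits along the filter of finite subsets, while Montel needs a
  sequence. Initial segments of an enumeration of \<open>A\<close> connect the two.\<close>

lemma countable_exhaustion:
  assumes "countable A"
  obtains X :: "nat \<Rightarrow> 'a set" where "\<And>n. finite (X n)" "\<And>n. X n \<subseteq> A"
    "filterlim X (finite_subsets_at_top A) sequentially"
proof (rule that)
  let ?X = "\<lambda>n. {a \<in> A. to_nat_on A a < n}"
  show fin: "finite (?X n)" for n
    using finite_vimage_IntI[OF finite_lessThan inj_on_to_nat_on[OF assms], of n]
    by (rule rev_finite_subset) auto
  show "?X n \<subseteq> A" for n
    by auto
  show "filterlim ?X (finite_subsets_at_top A) sequentially"
    unfolding filterlim_finite_subsets_at_top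
  proof (intro allI impI, elim conjE)
    fix Y assume Y: "finite Y" "Y \<subseteq> A"
    obtain N where N: "\<And>y. y \<in> Y \<Longrightarrow> to_nat_on A y < N"
      using finite_nat_set_iff_bounded[of "to_nat_on A ` Y"] Y by auto
    show "\<forall>\<^sub>F n in sequentially. finite (?X n) \<and> Y \<subseteq> ?X n \<and> ?X n \<subseteq> A"
      using eventually_ge_at_top[of N]
      by eventually_elim (use fin Y N in \<open>auto intro: less_le_trans\<close>)
  qed
qed

text \<open>The squared modulus of \<open>h i\<close> is not holomorphic in general, but multiplying
  \<open>h i\<close> by its Schwarz reflection is, and the two agree on the real axis.\<close>

lemma holomorphic_sum_mult_cnj:
  fixes h :: "'i \<Rightarrow> complex \<Rightarrow> complex"
  assumes "countable I" and hol: "\<And>i. i \<in> I \<Longrightarrow> h i holomorphic_on UNIV"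
    and bound: "\<And>K F z. 0 \<le> K \<Longrightarrow> finite F \<Longrightarrow> F \<subseteq> I \<Longrightarrow> cmod z \<le> K \<Longrightarrow>
      (\<Sum>i\<in>F. (cmod (h i z))\<^sup>2) \<le> B K"
  shows "(\<lambda>z. \<Sum>\<^sub>\<infinity>i\<in>I. h i z * cnj (h i (cnj z))) holomorphic_on UNIV"
proof -
  define p where "p i z = h i z * cnj (h i (cnj z))" for i z
  \<comment> \<open>By 2|uv| \<le> |u|^2 + |v|^2 the summands are controlled by the squares at
    \<open>z\<close> and at \<open>cnj z\<close>. Both points have the same modulus, so averaging
    the two estimates keeps the bound \<open>B K\<close>.\<close>
  have bound_p: "(\<Sum>i\<in>F. cmod (p i z)) \<le> B K"
    if "0 \<le> K" "finite F" "F \<subseteq> I" "cmod z \<le> K" for F z K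
  proof -
    have "(\<Sum>i\<in>F. cmod (p i z)) \<le> (\<Sum>i\<in>F. ((cmod (h i z))\<^sup>2 + (cmod (h i (cnj z)))\<^sup>2) / 2)"
    proof (rule sum_mono)
      fix i
      show "cmod (p i z) \<le> ((cmod (h i z))\<^sup>2 + (cmod (h i (cnj z)))\<^sup>2) / 2"
        using sum_squares_bound[of "cmod (h i z)" "cmod (h i (cnj z))"]
        by (simp add: p_def norm_mult)
    qed
    also have "\<dots> = ((\<Sum>i\<in>F. (cmod (h i z))\<^sup>2) + (\<Sum>i\<in>F. (cmod (h i (cnj z)))\<^sup>2)) / 2"
      by (simp add: sum.distrib flip: sum_divide_distrib)
    also have "\<dots> \<le> B K"
      using bound[of K F z] bound[of K F "cnj z"] that by simp
    finally show ?thesis .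
  qed
  have summable: "(\<lambda>i. p i z) summable_on I" for z
  proof (rule abs_summable_summable, rule nonneg_bdd_above_summable_on)
    show "bdd_above (sum (\<lambda>i. cmod (p i z)) ` {F. F \<subseteq> I \<and> finite F})"
      by (rule bdd_aboveI2[where M = "B (cmod z)"]) (use bound_p in auto)
  qed auto
  obtain X :: "nat \<Rightarrow> 'i set" where X: "\<And>n. finite (X n)" "\<And>n. X n \<subseteq> I"
    and lim: "filterlim X (finite_subsets_at_top I) sequentially"
    using countable_exhaustion[OF \<open>countable I\<close>] by metis
  have hol_p: "p i holomorphic_on UNIV" if "i \<in> I" for i
  proof -
    have "cnj \<circ> h i \<circ> cnj holomorphic_on UNIV"
      using hol[OF that] by (intro holomorphic_on_compose_cnj_cnj) (auto intro: holomorphic_on_subset)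
    then show ?thesis
      unfolding p_def using hol[OF that] by (auto simp: o_def intro!: holomorphic_intros)
  qed
  have "(\<lambda>z. \<Sum>\<^sub>\<infinity>i\<in>I. p i z) holomorphic_on UNIV"
  proof (rule holomorphic_pointwise_limit_bounded[where f = "\<lambda>n z. \<Sum>i\<in>X n. p i z"])
    show "(\<lambda>z. \<Sum>i\<in>X n. p i z) holomorphic_on UNIV" for n
      using X(2) hol_p by (intro holomorphic_on_sum) auto
    show "(\<lambda>n. \<Sum>i\<in>X n. p i z) \<longlonglongrightarrow> (\<Sum>\<^sub>\<infinity>i\<in>I. p i z)" for z
      using filterlim_compose[OF infsum_tendsto[OF summable] lim] .
    fix K :: "complex set" assume "compact K"
    then obtain r where r: "\<And>z. z \<in> K \<Longrightarrow> cmod z \<le> r" "r > 0"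
      by (meson compact_imp_bounded bounded_pos)
    then show "\<exists>C. \<forall>n. \<forall>z\<in>K. cmod (\<Sum>i\<in>X n. p i z) \<le> C"
      using bound_p[OF _ X] by (intro exI[of _ "B r"]) (auto intro: order_trans[OF norm_sum])
  qed simp
  then show ?thesis
    by (simp add: p_def)
qed

section \<open>The spectral function\<close>

theorem theorem2p4:
  fixes \<mu> :: "real measure" and \<Gamma> :: "real set"
  assumes "prob_space \<mu>" and "sets \<mu> = sets borel"
    and "compact (measure_support \<mu>)"
    and "countable \<Gamma>"
    and "\<exists>S. bounded_l2_L2_operator \<Gamma> \<mu> S \<and>
             (\<forall>\<gamma>\<in>\<Gamma>. AE x in \<mu>. S (delta \<gamma>) x = expo \<gamma> x)"
  shows "(\<forall>t::real. (\<lambda>\<gamma>. (cmod (fourier_transform \<mu> (\<gamma> + t)))\<^sup>2) summable_on \<Gamma>) \<and>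
         (\<exists>F. F holomorphic_on UNIV \<and>
              (\<forall>t::real. F (of_real t) = of_real (spectral_function \<mu> \<Gamma> t)))"
proof -
  interpret prob_space \<mu> by fact
  note sets = \<open>sets \<mu> = sets borel\<close>
  note [measurable_cong] = sets
  obtain R where R: "R > 0" "\<And>x. x \<in> measure_support \<mu> \<Longrightarrow> norm x \<le> R"
    using compact_imp_bounded[OF assms(3)] by (meson bounded_pos)
  have AE_R: "AE x in \<mu>. \<bar>x\<bar> \<le> R"
    using AE_in_measure_support[OF sets] by eventually_elim (use R(2) in force)
  \<comment> \<open>For real \<open>z\<close> this is again an exponential of modulus 1; for complex
    \<open>z\<close> it is the test function fed into the Bessel inequality.\<close>
  define E where "E z x = exp (2 * of_real pi * \<i> * of_real x * z)" for z :: complex and x :: real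
  define h where "h \<gamma> z = (LINT x|\<mu>. expo \<gamma> x * E z x)" for \<gamma> z
  have [measurable]: "expo \<gamma> \<in> borel_measurable \<mu>" "E z \<in> borel_measurable \<mu>" for \<gamma> z
    unfolding expo_def[abs_def] E_def[abs_def] by measurable
  have norm_expo: "cmod (expo \<gamma> x) = 1" for \<gamma> x
    by (simp add: expo_def)
  \<comment> \<open>The modulus is exp(-2 pi x Im z). Estimating it through |z| gives one constant
    for the whole disk of radius \<open>K\<close>.\<close>
  have E_bound: "AE x in \<mu>. cmod (E z x) \<le> exp (2 * pi * R * K)" if "cmod z \<le> K" for z K
    using AE_R
  proof eventually_elim
    case (elim x)
    have "Re (2 * of_real pi * \<i> * of_real x * z) \<le> 2 * pi * \<bar>x\<bar> * cmod z"
      by (rule order_trans[OF complex_Re_le_cmod]) (simp add: norm_mult)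
    also have "\<dots> \<le> 2 * pi * R * K"
      using elim that R by (intro mult_mono) auto
    finally show ?case
      by (simp only: E_def norm_exp_eq_Re exp_le_cancel_iff)
  qed
  have int_E2: "integrable \<mu> (\<lambda>x. (cmod (E z x))\<^sup>2)"
    and int_expo_E: "integrable \<mu> (\<lambda>x. expo \<gamma> x * E z x)" for \<gamma> z
  proof -
    show "integrable \<mu> (\<lambda>x. (cmod (E z x))\<^sup>2)"
      by (rule integrable_const_bound[where B = "(exp (2 * pi * R * cmod z))\<^sup>2"])
        (use E_bound[OF order_refl] in \<open>auto elim!: eventually_mono intro!: power_mono\<close>)
    show "integrable \<mu> (\<lambda>x. expo \<gamma> x * E z x)"
      by (rule integrable_const_bound[where B = "exp (2 * pi * R * cmod z)"])
        (use E_bound[OF order_refl] in \<open>auto simp: norm_mult norm_expo\<close>)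
  qed
  obtain S where S: "bounded_l2_L2_operator \<Gamma> \<mu> S"
    "\<And>\<gamma>. \<gamma> \<in> \<Gamma> \<Longrightarrow> AE x in \<mu>. S (delta \<gamma>) x = expo \<gamma> x"
    using assms(5) by blast
  obtain B where B: "B \<ge> 0"
    "\<And>F g. \<lbrakk>finite F; F \<subseteq> \<Gamma>; integrable \<mu> (\<lambda>x. (cmod (g x))\<^sup>2);
        \<And>\<gamma>. \<gamma> \<in> F \<Longrightarrow> integrable \<mu> (\<lambda>x. expo \<gamma> x * g x)\<rbrakk> \<Longrightarrow>
      (\<Sum>\<gamma>\<in>F. (cmod (LINT x|\<mu>. expo \<gamma> x * g x))\<^sup>2) \<le> B * (LINT x|\<mu>. (cmod (g x))\<^sup>2)"
    by (rule bessel_bound[OF S]) auto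
  \<comment> \<open>The Bessel inequality for \<open>g = E z\<close>, where total mass 1 turns the
    almost everywhere bound on \<open>E z\<close> into a bound on its squared norm. The result is
    uniform in \<open>F\<close> and in \<open>z\<close> over the disk, as the series lemma
    requires.\<close>
  have bound: "(\<Sum>\<gamma>\<in>F. (cmod (h \<gamma> z))\<^sup>2) \<le> B * (exp (2 * pi * R * K))\<^sup>2"
    if "finite F" "F \<subseteq> \<Gamma>" "cmod z \<le> K" for F z K
  proof -
    have "(LINT x|\<mu>. (cmod (E z x))\<^sup>2) \<le> (exp (2 * pi * R * K))\<^sup>2"
      by (rule integral_le_const[OF int_E2])
        (use E_bound[OF that(3)] in \<open>auto elim!: eventually_mono intro!: power_mono\<close>)
    then show ?thesis
      using B(2)[OF that(1,2) int_E2 int_expo_E, of z] \<open>B \<ge> 0\<close>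
      unfolding h_def by (meson mult_left_mono order_trans)
  qed
  have h_real: "h \<gamma> (of_real t) = fourier_transform \<mu> (\<gamma> + t)" for \<gamma> t
    unfolding h_def fourier_transform_def E_def expo_def
    by (simp add: algebra_simps flip: exp_add)
  \<comment> \<open>An infinite sum over a non-summable family is 0 by convention; this step ensures
    that \<open>spectral_function\<close> is the genuine sum. It is used again to move
    \<open>of_real\<close> through the sum.\<close>
  have summable: "(\<lambda>\<gamma>. (cmod (fourier_transform \<mu> (\<gamma> + t)))\<^sup>2) summable_on \<Gamma>" for t
  proof (rule nonneg_bdd_above_summable_on)
    show "bdd_above (sum (\<lambda>\<gamma>. (cmod (fourier_transform \<mu> (\<gamma> + t)))\<^sup>2) ` {F. F \<subseteq> \<Gamma> \<and> finite F})"
      by (rule bdd_aboveI2[where M = "B * (exp (2 * pi * R * \<bar>t\<bar>))\<^sup>2"])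
        (use bound[of _ "of_real t" "\<bar>t\<bar>"] in \<open>auto simp: h_real\<close>)
  qed auto
  define G where "G z = (\<Sum>\<^sub>\<infinity>\<gamma>\<in>\<Gamma>. h \<gamma> z * cnj (h \<gamma> (cnj z)))" for z
  have "h \<gamma> holomorphic_on UNIV" for \<gamma>
    unfolding h_def E_def
    by (rule holomorphic_fourier_laplace[OF _ sets AE_R])
      (rule integrable_const_bound[where B = 1], auto simp: norm_expo)
  then have "G holomorphic_on UNIV"
    unfolding G_def[abs_def] using bound by (intro holomorphic_sum_mult_cnj[OF assms(4)]) auto
  \<comment> \<open>Conjugation fixes real points, so each summand of \<open>G\<close> becomes the
    squared modulus of the Fourier transform at \<open>\<gamma> + t\<close>.\<close>
  moreover have "G (of_real t) = of_real (spectral_function \<mu> \<Gamma> t)" for t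
    unfolding G_def spectral_function_def
    using infsumI[OF has_sum_of_real[OF has_sum_infsum[OF summable[of t]], where ?'a = complex]]
    by (simp add: h_real complex_norm_square del: of_real_power)
  ultimately show ?thesis
    using summable by blast
qed

end
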